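(* Let $h\ge0$ and $c>0$ be such that $(h,c)\in\mathcal{D}$, i.e. such that there is a real $\lambda$ with $$\lambda^2-c\lambda+1+e^{-\lambda ch+ch}<0,$$ and let $u=\phi(x+ct)$ be a traveling wave for the KPP-Fisher delayed equation $$u_t(t,x)=u_{xx}(t,x)+u(t,x)(1-u(t-h,x)),\qquad t>0,\ x\in\mathbb{R}.$$ Let $u(t,x)$ be the solution of this equation with $u(s,x)=u_0(s,x)$, $s\in[-h,0]$, $x\in\mathbb{R}$, where the non-negative function $u_0$ satisfies, for some $\lambda^*>\lambda_1$, $K>0$ and some continuous $\alpha_0:[-h,0]\to\mathbb{R}$, $$|u_0(s,x)-\phi(x+cs+\alpha_0(s))|\le Ke^{\lambda^*x},\qquad (s,x)\in[-h,0]\times\mathbb{R}.$$ Then there exist $\mu\in(\lambda_1,2\lambda_1)$, $\gamma<0$ and $Q\ge K$ such that $$|u(t,x)-\phi(x+ct+\alpha_0(0))|\le Qe^{\mu(x+ct)}e^{\gamma t},\qquad x\in\mathbb{R},\ t\ge0.$$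
   Context: A traveling wave is a solution $u(t,x)=\phi(x+ct)$ with positive profile $\phi$ satisfying $\phi(-\infty)=0$, $\liminf_{t\to+\infty}\phi(t)>0$ and $\sup_{\mathbb{R}}\phi<\infty$ (monotonicity of $\phi$ is not assumed). Here $0<\lambda_1<\lambda_2$ are the zeros of $\chi_0(z)=z^2-cz+1$, and it is assumed that, after an appropriate translation of the independent variable, $\phi(t)=e^{\lambda_1t}+e^{(\lambda_1+\sigma)t}r_1(t)$ and $\phi'(t)=\lambda_1e^{\lambda_1t}+e^{(\lambda_1+\sigma)t}r_2(t)$, $t\in\mathbb{R}$, for some $\sigma>0$ with $\lambda_1+\sigma<\lambda_2$ and some smooth bounded functions $r_1,r_2$. Standing assumption: $u_0(s,x)$ is bounded and globally Lipschitz continuous in $x$, uniformly in $s\in[-h,0]$. *)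

theory Defs
  imports "HOL-Analysis.Analysis"
begin

definition chi0 :: "real \<Rightarrow> real \<Rightarrow> real" where
  "chi0 c z = z\<^sup>2 - c * z + 1"

definition kpp_domain :: "(real \<times> real) set" where
  "kpp_domain = {(h, c). h \<ge> 0 \<and> c > 0 \<and>
     (\<exists>l::real. l\<^sup>2 - c * l + 1 + exp (- l * c * h + c * h) < 0)}"

text \<open>
  The delayed KPP-Fisher equation for \<open>t > 0\<close>, \<open>x\<close> real, in the classical pointwise sense.
  Continuity of the derivatives is not demanded, so every solution that is
  continuously differentiable once in time and twice in space is covered.
\<close>
definition kpp_equation :: "real \<Rightarrow> (real \<Rightarrow> real \<Rightarrow> real) \<Rightarrow> bool" where
  "kpp_equation h u \<longleftrightarrow>
     (\<exists>u_t u_x u_xx :: real \<Rightarrow> real \<Rightarrow> real. \<forall>t>0. \<forall>x.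
        ((\<lambda>\<tau>. u \<tau> x) has_real_derivative u_t t x) (at t) \<and>
        ((\<lambda>y. u t y) has_real_derivative u_x t x) (at x) \<and>
        ((\<lambda>y. u_x t y) has_real_derivative u_xx t x) (at x) \<and>
        u_t t x = u_xx t x + u t x * (1 - u (t - h) x))"

text \<open>
  Solution of the initial value problem. Boundedness on finite time strips is the usual
  condition under which one may speak of \<^emph>\<open>the\<close> solution on an unbounded spatial domain;
  no bound uniform in time is required. Continuity is required only for \<open>t \<ge> 0\<close>, so it
  imposes nothing on the initial datum for negative times.
\<close>
definition kpp_solution ::
    "real \<Rightarrow> (real \<Rightarrow> real \<Rightarrow> real) \<Rightarrow> (real \<Rightarrow> real \<Rightarrow> real) \<Rightarrow> bool" where
  "kpp_solution h u0 u \<longleftrightarrow>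
     kpp_equation h u \<and>
     (\<forall>s\<in>{-h..0}. \<forall>x. u s x = u0 s x) \<and>
     continuous_on ({0..} \<times> UNIV) (\<lambda>(t, x). u t x) \<and>
     (\<forall>T. bounded ((\<lambda>(t, x). u t x) ` ({0..T} \<times> UNIV)))"

definition traveling_wave :: "real \<Rightarrow> real \<Rightarrow> (real \<Rightarrow> real) \<Rightarrow> bool" where
  "traveling_wave h c \<phi> \<longleftrightarrow>
     kpp_equation h (\<lambda>t x. \<phi> (x + c * t)) \<and>
     (\<forall>z. \<phi> z > 0) \<and>
     (\<phi> \<longlongrightarrow> 0) at_bot \<and>
     Liminf at_top (\<lambda>z. ereal (\<phi> z)) > 0 \<and>
     bdd_above (range \<phi>)"

definition smooth_fun :: "(real \<Rightarrow> real) \<Rightarrow> bool" where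
  "smooth_fun r \<longleftrightarrow> (\<forall>n. (deriv ^^ n) r differentiable_on UNIV)"

text \<open>
  Asymptotics of the profile at minus infinity; \<open>a\<close> is the translation of the independent
  variable which normalizes the leading coefficient to 1.
\<close>
definition wave_asymptotics :: "real \<Rightarrow> real \<Rightarrow> (real \<Rightarrow> real) \<Rightarrow> bool" where
  "wave_asymptotics l1 l2 \<phi> \<longleftrightarrow>
     (\<exists>a \<sigma> r1 r2. \<sigma> > 0 \<and> l1 + \<sigma> < l2 \<and>
        smooth_fun r1 \<and> smooth_fun r2 \<and> bounded (range r1) \<and> bounded (range r2) \<and>
        (\<forall>t. \<phi> (t + a) = exp (l1 * t) + exp ((l1 + \<sigma>) * t) * r1 t) \<and>
        (\<forall>t. deriv \<phi> (t + a) = l1 * exp (l1 * t) + exp ((l1 + \<sigma>) * t) * r2 t))"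

end

theory Submission
  imports Defs
begin

text \<open>
  Put \<open>z = x + c t\<close> and let \<open>v t x = \<phi> (x + c t + \<alpha>0 0)\<close> be the shifted wave. The difference
  \<open>\<delta> = u - v\<close> satisfies
  \<open>\<delta>_t = \<delta>_xx + \<delta> (1 - u (t - h)) - v \<delta> (t - h)\<close>,
  and since \<open>u\<close> and \<open>v\<close> are nonnegative, \<open>\<bar>\<delta>\<bar>\<close> is dominated by every supersolution \<open>S\<close> of the linear
  equation \<open>S_t = S_xx + S + v S (t - h)\<close> that dominates it initially
  (\<open>perturbation_comparison\<close>). An exponential \<open>exp (r z + \<gamma> t)\<close> turns this into the requirement
  \<open>chi0 c r + v exp (- r c h - \<gamma> h) \<le> \<gamma>\<close>.

  Two exponents matter. The bound \<open>\<phi> \<le> exp (c h)\<close> (\<open>wave_profile_le\<close>) makes the inequality that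
  defines the parameter domain say exactly that some \<open>\<nu>\<close> satisfies the requirement for a small negative
  \<open>\<gamma>\<close>, uniformly in \<open>z\<close>. The initial perturbation, however, is only known to be of order
  \<open>exp (\<mu> z)\<close> at minus infinity for \<open>\<mu>\<close> slightly above \<open>l1\<close>. Such a \<open>\<mu>\<close> is sure to satisfy the requirement
  only where \<open>v\<close> is small, that is, far to the left. The sum \<open>exp (\<mu> z) + A exp (\<nu> z)\<close> combines the
  two: its second term with \<open>A\<close> large pays for the defect of the first one on the right, and is
  negligible on the left (\<open>perturbation_weighted_decay\<close>).

  The phase \<open>\<alpha>0\<close> may vary on the initial interval, so before time zero \<open>\<delta>\<close> is only of order
  \<open>exp (l1 z)\<close>. In the equation this past enters multiplied by \<open>v\<close>, which is of the same order,
  and the product \<open>exp (2 l1 z)\<close> is harmless as long as \<open>\<mu> < 2 l1\<close>.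

  The result controls \<open>\<delta>\<close> by \<open>exp (\<nu> z + \<gamma> t)\<close> on the right half-line, where \<open>\<nu>\<close> may be much
  larger than \<open>2 l1\<close>. The solution may grow in time there, but the linear equation without delay term
  already yields \<open>u \<le> C exp (l1 z)\<close> for all times (\<open>kpp_solution_exp_bound\<close>). Interpolation
  between the two bounds gives every exponent between \<open>l1\<close> and \<open>\<nu>\<close>, with a proportionally smaller
  decay rate; the weight \<open>\<theta>\<close> is chosen such that the interpolated exponent is \<open>\<mu>\<close>.
\<close>

section \<open>A maximum principle on strips\<close>

lemma second_derivative_nonpos_at_max:
  fixes f f' :: "real \<Rightarrow> real"
  assumes lo: "a < x" and hi: "x < b"
    and max: "\<And>y. a < y \<Longrightarrow> y < b \<Longrightarrow> f y \<le> f x"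
    and f': "\<And>y. (f has_real_derivative f' y) (at y)"
    and f'': "(f' has_real_derivative q) (at x)"
  shows "f' x = 0" and "q \<le> 0"
proof -
  show f'0: "f' x = 0"
  proof (rule DERIV_local_max[OF f'])
    show "0 < min (x - a) (b - x)" using lo hi by simp
    show "\<forall>y. \<bar>x - y\<bar> < min (x - a) (b - x) \<longrightarrow> f y \<le> f x"
      using max by (auto simp: abs_if split: if_splits)
  qed
  show "q \<le> 0"
  proof (rule ccontr)
    assume "\<not> q \<le> 0"
    then obtain d where d: "d > 0" and pos: "\<And>e. 0 < e \<Longrightarrow> e < d \<Longrightarrow> f' x < f' (x + e)"
      using DERIV_pos_inc_right[OF f''] by auto
    define y where "y = x + min (d/2) ((b - x)/2)"
    have y: "x < y" "y < b" "y < x + d" using d hi by (auto simp: y_def min_def field_simps)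
    obtain \<xi> where "x < \<xi>" "\<xi> < y" "f y - f x = (y - x) * f' \<xi>"
      using MVT2[OF y(1), of f f'] f' by auto
    moreover have "f' \<xi> > 0" using pos[of "\<xi> - x"] f'0 calculation y by auto
    ultimately have "f y > f x" using y by (smt (verit) mult_pos_pos)
    then show False using max[of y] y lo by auto
  qed
qed

text \<open>
  Only points where \<open>W\<close> is positive have to satisfy the differential inequality; this allows the
  sign of a difference of two solutions to be used when the right-hand side is estimated, so that
  its absolute value can be treated through both signs separately. Since space is unbounded,
  a maximum is forced by subtracting \<open>\<epsilon> (1 + x\<^sup>2)\<close> from \<open>W exp (- b t)\<close>. At a positive
  maximum the time derivative gives \<open>W_t \<ge> b W\<close> and the space derivatives give
  \<open>W_xx exp (- b t) \<le> 2 \<epsilon>\<close>, hence \<open>(b - k) W exp (- b t) \<le> 2 \<epsilon>\<close>, whereas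
  \<open>W exp (- b t) > \<epsilon>\<close>. Any \<open>b\<close> with \<open>b - k \<ge> 2\<close> is contradictory.
\<close>

lemma parabolic_maximum_principle:
  fixes W :: "real \<Rightarrow> real \<Rightarrow> real"
  assumes cont: "continuous_on ({0..T} \<times> UNIV) (\<lambda>(t, x). W t x)"
    and bdd: "\<And>t x. 0 \<le> t \<Longrightarrow> t \<le> T \<Longrightarrow> W t x \<le> B"
    and init: "\<And>x. W 0 x \<le> 0"
    and subsol: "\<And>t x. 0 < t \<Longrightarrow> t \<le> T \<Longrightarrow> W t x > 0 \<Longrightarrow>
      \<exists>a p q. ((\<lambda>\<tau>. W \<tau> x) has_real_derivative a) (at t) \<and>
        (\<forall>y. (W t has_real_derivative p y) (at y)) \<and>
        (p has_real_derivative q) (at x) \<and> a \<le> q + k * W t x"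
    and t: "0 \<le> t" "t \<le> T"
  shows "W t x \<le> 0"
proof (rule ccontr)
  assume "\<not> W t x \<le> 0"
  then have pos: "W t x > 0" by simp
  define b where "b = k + 3"
  define \<epsilon> where "\<epsilon> = W t x * exp (- (b * t)) / (2 * (1 + x\<^sup>2))"
  define V where "V = (\<lambda>s y. W s y * exp (- (b * s)) - \<epsilon> * (1 + y\<^sup>2))"
  have sq: "1 + y\<^sup>2 > 0" for y :: real by (smt (verit) zero_le_power2)
  have \<epsilon>: "\<epsilon> > 0" using pos sq[of x] by (simp add: \<epsilon>_def del: power2_eq_square)
  have "\<epsilon> * (1 + x\<^sup>2) = W t x * exp (- (b * t)) / 2"
    using sq[of x] by (simp add: \<epsilon>_def field_simps)
  moreover have "W t x * exp (- (b * t)) > 0" using pos by simp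
  ultimately have Vpos: "V t x > 0" unfolding V_def by linarith
  define D where "D = \<bar>B\<bar> * exp (\<bar>b\<bar> * T)"
  have WD: "W s y * exp (- (b * s)) \<le> D" if "0 \<le> s" "s \<le> T" for s y
  proof -
    have "W s y * exp (- (b * s)) \<le> \<bar>B\<bar> * exp (- (b * s))"
      using bdd[OF that, of y] by (intro mult_right_mono) auto
    also have "- (b * s) \<le> \<bar>b\<bar> * T"
    proof -
      have "- (b * s) \<le> \<bar>b\<bar> * s"
        using mult_right_mono[of "- b" "\<bar>b\<bar>" s] that by simp
      also have "\<dots> \<le> \<bar>b\<bar> * T" using that by (intro mult_left_mono) auto
      finally show ?thesis .
    qed
    then have "\<bar>B\<bar> * exp (- (b * s)) \<le> D"
      unfolding D_def by (intro mult_left_mono) auto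
    finally show ?thesis .
  qed
  \<comment> \<open>Beyond \<open>R\<close> the quadratic penalty exceeds every value of the damped function.\<close>
  define R where "R = D / \<epsilon> + \<bar>x\<bar> + 1"
  have D0: "D \<ge> 0" by (simp add: D_def)
  have R1: "R \<ge> 1" using D0 \<epsilon> by (simp add: R_def)
  have outside: "V s y < 0" if "0 \<le> s" "s \<le> T" "\<bar>y\<bar> \<ge> R" for s y
  proof -
    have "D / \<epsilon> < R" by (simp add: R_def)
    also have "R \<le> R * R" using R1 mult_left_mono[of 1 R R] by simp
    also have "\<dots> \<le> \<bar>y\<bar> * \<bar>y\<bar>" using R1 that by (intro mult_mono) auto
    also have "\<dots> = y\<^sup>2" by (simp add: power2_eq_square)
    finally have "D < \<epsilon> * y\<^sup>2" using \<epsilon> by (simp add: field_simps)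
    then have "D < \<epsilon> * (1 + y\<^sup>2)" using \<epsilon> by (simp add: algebra_simps)
    then show ?thesis using WD[OF that(1,2), of y] by (simp add: V_def)
  qed
  have "continuous_on ({0..T} \<times> {-R..R}) (\<lambda>(s, y). V s y)"
  proof -
    have "continuous_on ({0..T} \<times> {-R..R}) (\<lambda>(s, y). W s y)"
      by (rule continuous_on_subset[OF cont]) auto
    then have "continuous_on ({0..T} \<times> {-R..R})
        (\<lambda>p. (case p of (s, y) \<Rightarrow> W s y) * exp (- (b * fst p)) - \<epsilon> * (1 + (snd p)\<^sup>2))"
      by (intro continuous_intros)
    then show ?thesis by (simp add: V_def case_prod_beta')
  qed
  moreover have "compact ({0..T} \<times> {-R..R})" by (intro compact_Times) auto
  moreover have xin: "(t, x) \<in> {0..T} \<times> {-R..R}"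
  proof -
    have "D / \<epsilon> \<ge> 0" using D0 \<epsilon> by simp
    then show ?thesis using t by (auto simp: R_def)
  qed
  ultimately obtain p where p: "p \<in> {0..T} \<times> {-R..R}"
    and pmax: "\<forall>r\<in>{0..T} \<times> {-R..R}. (case r of (s, y) \<Rightarrow> V s y) \<le> (case p of (s, y) \<Rightarrow> V s y)"
    using continuous_attains_sup[of "{0..T} \<times> {-R..R}" "\<lambda>(s, y). V s y"] by blast
  obtain s y where py: "p = (s, y)" by (cases p)
  have s: "0 \<le> s" "s \<le> T" using p py by auto
  have Vmax0: "V s' y' \<le> V s y" if "0 \<le> s'" "s' \<le> T" "\<bar>y'\<bar> \<le> R" for s' y'
    using pmax that by (auto simp: py abs_if split: if_splits)
  have Vs: "V s y > 0" using Vpos Vmax0[of t x] xin t by force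
  have Vmax: "V s' y' \<le> V s y" if "0 \<le> s'" "s' \<le> T" for s' y'
    using Vmax0[OF that, of y'] outside[OF that, of y'] Vs by (cases "\<bar>y'\<bar> \<le> R") auto
  have Wlow: "W s y * exp (- (b * s)) > \<epsilon> * (1 + y\<^sup>2)" using Vs by (simp add: V_def)
  then have Wpos: "W s y > 0"
    using \<epsilon> sq[of y] by (smt (verit) exp_gt_zero mult_pos_pos zero_less_mult_pos2)
  have s0: "s > 0" using init[of y] Wpos s by (cases "s = 0") auto
  obtain a p' q where a: "((\<lambda>\<tau>. W \<tau> y) has_real_derivative a) (at s)"
    and p': "\<And>y'. (W s has_real_derivative p' y') (at y')"
    and q: "(p' has_real_derivative q) (at y)" and le: "a \<le> q + k * W s y"
    using subsol[OF s0 s(2) Wpos] by blast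
  define E where "E = exp (- (b * s))"
  have E: "E > 0" by (simp add: E_def)
  have "q * E - 2 * \<epsilon> \<le> 0"
  proof (rule second_derivative_nonpos_at_max(2))
    show "y - 1 < y" "y < y + 1" by auto
    show "V s y' \<le> V s y" for y' using Vmax s by auto
    show "(V s has_real_derivative p' y' * E - \<epsilon> * (2 * y')) (at y')" for y'
      unfolding V_def E_def by (auto intro!: derivative_eq_intros p')
    show "((\<lambda>y'. p' y' * E - \<epsilon> * (2 * y')) has_real_derivative q * E - 2 * \<epsilon>) (at y)"
      by (auto intro!: derivative_eq_intros q)
  qed
  moreover have "(a - b * W s y) * E \<ge> 0"
  proof (rule ccontr)
    assume "\<not> ?thesis"
    moreover have "((\<lambda>\<tau>. V \<tau> y) has_real_derivative (a - b * W s y) * E) (at s)"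
      unfolding V_def E_def by (auto intro!: derivative_eq_intros a simp: algebra_simps)
    ultimately obtain d where d: "d > 0"
      and dec: "\<And>e. 0 < e \<Longrightarrow> e < d \<Longrightarrow> V s y < V (s - e) y"
      using DERIV_neg_dec_left[of "\<lambda>\<tau>. V \<tau> y"] by (metis not_le)
    have "V s y < V (s - min (d/2) s) y" using d s0 by (intro dec) auto
    then show False using Vmax[of "s - min (d/2) s" y] s0 s d by (auto simp: min_def split: if_splits)
  qed
  moreover have "a * E \<le> (q + k * W s y) * E" using le E by (intro mult_right_mono) auto
  ultimately have "b * W s y * E \<le> k * W s y * E + 2 * \<epsilon>"
    unfolding distrib_right left_diff_distrib by linarith
  then have "3 * (W s y * E) \<le> 2 * \<epsilon>" by (simp add: b_def algebra_simps)
  moreover have "W s y * E > \<epsilon>"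
  proof -
    have "\<epsilon> * y\<^sup>2 \<ge> 0" using \<epsilon> by simp
    then show ?thesis using Wlow by (simp add: E_def distrib_left)
  qed
  ultimately show False using \<epsilon> by linarith
qed

section \<open>Bounds on the wave profile\<close>

lemma wave_profile_ode:
  assumes "traveling_wave h c \<phi>" and c: "c > 0"
  shows "\<exists>\<phi>' \<phi>''. \<forall>z. (\<phi> has_real_derivative \<phi>' z) (at z) \<and>
    (\<phi>' has_real_derivative \<phi>'' z) (at z) \<and>
    \<phi>'' z = c * \<phi>' z - \<phi> z * (1 - \<phi> (z - c * h))"
proof -
  let ?w = "\<lambda>t x. \<phi> (x + c * t)"
  have "kpp_equation h ?w" using assms by (simp add: traveling_wave_def)
  then obtain ut ux uxx where
    eq: "\<And>t x. t > 0 \<Longrightarrow> ((\<lambda>\<tau>. \<phi> (x + c * \<tau>)) has_real_derivative ut t x) (at t) \<and>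
        ((\<lambda>y. \<phi> (y + c * t)) has_real_derivative ux t x) (at x) \<and>
        ((\<lambda>y. ux t y) has_real_derivative uxx t x) (at x) \<and>
        ut t x = uxx t x + \<phi> (x + c * t) * (1 - \<phi> (x + c * (t - h)))"
    unfolding kpp_equation_def by blast
  define \<phi>' where "\<phi>' = (\<lambda>z. ux 1 (z - c))"
  define \<phi>'' where "\<phi>'' = (\<lambda>z. uxx 1 (z - c))"
  have 1: "(\<phi> has_real_derivative \<phi>' z) (at z)" for z
  proof -
    have "((\<lambda>y. \<phi> (y + c)) has_real_derivative ux 1 (z - c)) (at (z + - c))"
      using eq[of 1 "z - c"] by simp
    then show ?thesis unfolding DERIV_shift by (simp add: \<phi>'_def)
  qed
  have 2: "(\<phi>' has_real_derivative \<phi>'' z) (at z)" for z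
  proof -
    have "((\<lambda>y. ux 1 y) has_real_derivative uxx 1 (z - c)) (at (z + - c))"
      using eq[of 1 "z - c"] by simp
    then show ?thesis unfolding DERIV_shift by (simp add: \<phi>'_def \<phi>''_def)
  qed
  have 3: "\<phi>'' z = c * \<phi>' z - \<phi> z * (1 - \<phi> (z - c * h))" for z
  proof -
    have e: "((\<lambda>\<tau>. \<phi> (z - c + c * \<tau>)) has_real_derivative ut 1 (z - c)) (at 1)"
        "ut 1 (z - c) = \<phi>'' z + \<phi> z * (1 - \<phi> (z - c * h))"
      using eq[of 1 "z - c"] by (simp_all add: \<phi>''_def algebra_simps)
    have "((\<lambda>\<tau>. \<phi> (z - c + c * \<tau>)) has_real_derivative \<phi>' z * c) (at 1)"
      by (rule DERIV_chain2[where f = \<phi> and g = "\<lambda>\<tau>. z - c + c * \<tau>"])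
         (use 1[of z] in \<open>auto intro!: derivative_eq_intros\<close>)
    then have "ut 1 (z - c) = \<phi>' z * c" using e(1) DERIV_unique by blast
    then show ?thesis using e(2) by (simp add: algebra_simps)
  qed
  show ?thesis using 1 2 3 by (intro exI[of _ \<phi>'] exI[of _ \<phi>'']) simp
qed

lemma not_bounded_if_derivative_ge:
  fixes f f' :: "real \<Rightarrow> real"
  assumes f': "\<And>z. (f has_real_derivative f' z) (at z)"
    and d: "d > 0" "\<And>z. z \<ge> z0 \<Longrightarrow> f' z \<ge> d"
  shows "\<not> bdd_above (range f)"
proof
  assume "bdd_above (range f)"
  then obtain B where B: "\<And>z. f z \<le> B" by (auto simp: bdd_above_def)
  define z where "z = z0 + (B - f z0) / d + 1"
  have "(B - f z0) / d \<ge> 0" using B[of z0] d by simp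
  then have z: "z > z0" by (simp add: z_def)
  obtain \<xi> where "z0 < \<xi>" "f z - f z0 = (z - z0) * f' \<xi>"
    using MVT2[OF z, of f f'] f' by auto
  then have "f z - f z0 \<ge> (z - z0) * d" using d(2)[of \<xi>] z by (simp add: mult_left_mono)
  also have "(z - z0) * d = B - f z0 + d" using d(1) by (simp add: z_def field_simps)
  finally show False using B[of z] d(1) by simp
qed

lemma chi0_factor:
  assumes "chi0 c l1 = 0" "chi0 c l2 = 0" "l1 < l2"
  shows "c = l1 + l2" and "l1 * l2 = 1" and "chi0 c z = (z - l1) * (z - l2)"
proof -
  have e1: "l1 * l1 = c * l1 - 1" and e2: "l2 * l2 = c * l2 - 1"
    using assms by (auto simp: chi0_def power2_eq_square)
  then have "(l2 - l1) * (l1 + l2 - c) = 0" by (simp add: algebra_simps)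
  then show c: "c = l1 + l2" using assms(3) by simp
  show l: "l1 * l2 = 1" using e1 unfolding c by (simp add: algebra_simps)
  show "chi0 c z = (z - l1) * (z - l2)"
    using l by (simp add: chi0_def c power2_eq_square algebra_simps)
qed

text \<open>
  Factoring the linearization at zero gives, for \<open>g = \<phi>' - l1 \<phi>\<close>, the identity
  \<open>g' - l2 g = \<phi> z * \<phi> (z - c h) > 0\<close>. So \<open>g exp (- l2 z)\<close> is increasing, and if \<open>g\<close> were positive
  anywhere, it would stay bounded away from zero and \<open>\<phi>\<close> would be unbounded.
\<close>

lemma wave_log_derivative_le:
  assumes wave: "traveling_wave h c \<phi>" and c: "c > 0"
    and roots: "0 < l1" "l1 < l2" "chi0 c l1 = 0" "chi0 c l2 = 0"
    and \<phi>': "\<And>z. (\<phi> has_real_derivative \<phi>' z) (at z)"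
    and \<phi>'': "\<And>z. (\<phi>' has_real_derivative \<phi>'' z) (at z)"
    and ode: "\<And>z. \<phi>'' z = c * \<phi>' z - \<phi> z * (1 - \<phi> (z - c * h))"
  shows "\<phi>' z \<le> l1 * \<phi> z"
proof (rule ccontr)
  assume neg: "\<not> ?thesis"
  have pos: "\<phi> y > 0" for y using wave by (simp add: traveling_wave_def)
  define G where "G = (\<lambda>y. (\<phi>' y - l1 * \<phi> y) * exp (- (l2 * y)))"
  have cl: "c = l1 + l2" "l1 * l2 = 1"
    using chi0_factor(1,2)[OF roots(3,4,2)] by blast+
  have G': "(G has_real_derivative \<phi> y * \<phi> (y - c * h) * exp (- (l2 * y))) (at y)" for y
  proof -
    have "(G has_real_derivative
        (\<phi>'' y - l1 * \<phi>' y) * exp (- (l2 * y)) + (\<phi>' y - l1 * \<phi> y) * (exp (- (l2 * y)) * - l2)) (at y)"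
    proof -
      have 1: "((\<lambda>y. exp (- (l2 * y))) has_real_derivative exp (- (l2 * y)) * - l2) (at y)"
        by (auto intro!: derivative_eq_intros)
      have 2: "((\<lambda>y. \<phi>' y - l1 * \<phi> y) has_real_derivative \<phi>'' y - l1 * \<phi>' y) (at y)"
        by (intro DERIV_diff DERIV_cmult \<phi>' \<phi>'')
      show ?thesis unfolding G_def using DERIV_mult[OF 2 1] by (simp add: algebra_simps)
    qed
    also have "(\<phi>'' y - l1 * \<phi>' y) * exp (- (l2 * y)) + (\<phi>' y - l1 * \<phi> y) * (exp (- (l2 * y)) * - l2)
        = (\<phi>'' y - c * \<phi>' y + (l1 * l2) * \<phi> y) * exp (- (l2 * y))"
      unfolding cl(1) by (simp add: algebra_simps)
    also have "\<dots> = \<phi> y * \<phi> (y - c * h) * exp (- (l2 * y))"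
      unfolding cl(2) ode[of y] by (simp add: algebra_simps)
    finally show ?thesis .
  qed
  have Gmono: "G z \<le> G y" if "z \<le> y" for y
    by (rule DERIV_nonneg_imp_nondecreasing[where f = G, OF that])
       (use G' pos in \<open>force intro: mult_nonneg_nonneg less_imp_le\<close>)
  define d where "d = \<phi>' z - l1 * \<phi> z"
  have "\<not> bdd_above (range \<phi>)"
  proof (rule not_bounded_if_derivative_ge[OF \<phi>'])
    show d: "d > 0" using neg by (simp add: d_def)
    show "\<phi>' y \<ge> d" if "y \<ge> z" for y
    proof -
      have "exp (- (l2 * z)) * d \<le> exp (- (l2 * y)) * (\<phi>' y - l1 * \<phi> y)"
        using Gmono[OF that] by (simp add: G_def d_def mult.commute)
      then have "exp (l2 * y) * (exp (- (l2 * z)) * d)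
          \<le> exp (l2 * y) * (exp (- (l2 * y)) * (\<phi>' y - l1 * \<phi> y))"
        by (rule mult_left_mono) simp
      then have "exp (l2 * (y - z)) * d \<le> \<phi>' y - l1 * \<phi> y"
        by (simp add: mult.assoc[symmetric] exp_add[symmetric] right_diff_distrib)
      moreover have "exp (l2 * (y - z)) \<ge> 1" using that roots by simp
      then have "d \<le> exp (l2 * (y - z)) * d" using d by simp
      moreover have "l1 * \<phi> y > 0" using roots pos by simp
      ultimately show ?thesis by linarith
    qed
  qed
  then show False using wave by (simp add: traveling_wave_def)
qed

text \<open>
  By the previous lemma \<open>\<phi>\<close> grows by at most the factor \<open>B = exp (l1 c h)\<close> over a distance
  \<open>c h\<close>, and \<open>l1 < 1\<close> because \<open>l1 l2 = 1\<close>. If \<open>\<phi> z > B\<close>, then \<open>\<phi> (z - c h) > 1\<close>, so the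
  equation reads \<open>\<phi>'' > c \<phi>'\<close> there and excludes interior maxima at height above \<open>B\<close>. As \<open>\<phi>\<close> vanishes at
  minus infinity, a value above \<open>B\<close> can then only be followed by a nondecreasing profile, which is
  moreover uniformly convex and thus unbounded.
\<close>

lemma wave_profile_le:
  assumes wave: "traveling_wave h c \<phi>" and c: "c > 0" and h: "h \<ge> 0"
    and roots: "0 < l1" "l1 < l2" "chi0 c l1 = 0" "chi0 c l2 = 0"
  shows "\<phi> z \<le> exp (c * h)"
proof -
  obtain \<phi>' \<phi>'' where prof: "\<forall>z. (\<phi> has_real_derivative \<phi>' z) (at z) \<and>
      (\<phi>' has_real_derivative \<phi>'' z) (at z) \<and>
      \<phi>'' z = c * \<phi>' z - \<phi> z * (1 - \<phi> (z - c * h))"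
    using wave_profile_ode[OF wave c] by (elim exE)
  have \<phi>': "\<And>z. (\<phi> has_real_derivative \<phi>' z) (at z)"
    and \<phi>'': "\<And>z. (\<phi>' has_real_derivative \<phi>'' z) (at z)"
    and ode: "\<And>z. \<phi>'' z = c * \<phi>' z - \<phi> z * (1 - \<phi> (z - c * h))"
    using prof by blast+
  have pos: "\<phi> y > 0" for y using wave by (simp add: traveling_wave_def)
  have logd: "\<phi>' y \<le> l1 * \<phi> y" for y
    by (rule wave_log_derivative_le[where \<phi>' = \<phi>' and \<phi>'' = \<phi>'']) (fact wave c roots \<phi>' \<phi>'' ode)+
  have delayed: "\<phi> y * exp (- (l1 * (c * h))) \<le> \<phi> (y - c * h)" for y
  proof -
    define F where "F = (\<lambda>y. \<phi> y * exp (- (l1 * y)))"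
    have F': "(F has_real_derivative (\<phi>' y - l1 * \<phi> y) * exp (- (l1 * y))) (at y)" for y
      unfolding F_def by (auto intro!: derivative_eq_intros \<phi>' simp: algebra_simps)
    have "F y \<le> F (y - c * h)"
    proof (rule DERIV_nonpos_imp_nonincreasing[where f = F])
      show "y - c * h \<le> y" using c h by simp
      show "\<exists>d. (F has_real_derivative d) (at x) \<and> d \<le> 0"
        if "y - c * h \<le> x" "x \<le> y" for x
        using F'[of x] mult_nonpos_nonneg[of "\<phi>' x - l1 * \<phi> x" "exp (- (l1 * x))"] logd[of x]
        by auto
    qed
    then have "exp (l1 * (y - c * h)) * (\<phi> y * exp (- (l1 * y)))
        \<le> exp (l1 * (y - c * h)) * (\<phi> (y - c * h) * exp (- (l1 * (y - c * h))))"
      unfolding F_def by (rule mult_left_mono) simp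
    also have "exp (l1 * (y - c * h)) * (\<phi> y * exp (- (l1 * y))) = \<phi> y * exp (- (l1 * (c * h)))"
      by (simp add: exp_add[symmetric] algebra_simps)
    also have "exp (l1 * (y - c * h)) * (\<phi> (y - c * h) * exp (- (l1 * (y - c * h)))) = \<phi> (y - c * h)"
      by (simp add: exp_minus)
    finally show ?thesis .
  qed
  define B where "B = exp (l1 * (c * h))"
  have B1: "B \<ge> 1" using roots c h by (simp add: B_def)
  have growth: "\<phi> y * (\<phi> y / B - 1) \<le> \<phi>'' y - c * \<phi>' y" for y
    using delayed[of y] pos[of y] unfolding ode[of y] B_def
    by (simp add: exp_minus field_simps)
  have "\<phi> z \<le> B"
  proof (rule ccontr)
    assume "\<not> \<phi> z \<le> B"
    then have zB: "\<phi> z > B" by simp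
    have "eventually (\<lambda>y. \<phi> y < \<phi> z) at_bot"
      using wave pos[of z] order_tendstoD(2)[of \<phi> 0 at_bot "\<phi> z"] by (auto simp: traveling_wave_def)
    then obtain N where N: "\<And>y. y \<le> N \<Longrightarrow> \<phi> y < \<phi> z" by (auto simp: eventually_at_bot_linorder)
    define z1 where "z1 = min N (z - 1)"
    have z1: "z1 < z" "\<phi> z1 < \<phi> z" using N by (auto simp: z1_def)
    have end_max: "\<phi> y \<le> \<phi> r" if "z \<le> r" "z1 \<le> y" "y \<le> r" for y r
    proof -
      have "continuous_on {z1..r} \<phi>"
        using \<phi>' by (meson DERIV_isCont continuous_at_imp_continuous_on)
      moreover have "{z1..r} \<noteq> {}" using that by simp
      ultimately obtain m where m: "m \<in> {z1..r}"
        and mmax: "\<And>y. y \<in> {z1..r} \<Longrightarrow> \<phi> y \<le> \<phi> m"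
        using continuous_attains_sup[of "{z1..r}" \<phi>] compact_Icc by blast
      have mz: "\<phi> m \<ge> \<phi> z" using mmax[of z] z1 that by auto
      have "m = r"
      proof (rule ccontr)
        assume "m \<noteq> r"
        then have mr: "z1 < m" "m < r" using m mz z1 by (auto simp: le_less)
        have "\<phi>' m = 0" "\<phi>'' m \<le> 0"
          by (rule second_derivative_nonpos_at_max[where f = \<phi> and f' = \<phi>', OF mr];
              use mmax \<phi>' \<phi>'' in auto)+
        moreover have "\<phi> m * (\<phi> m / B - 1) > 0"
          using mz zB B1 pos[of m] by simp
        ultimately show False using growth[of m] by simp
      qed
      then show ?thesis using mmax that by auto
    qed
    have \<phi>'_nonneg: "\<phi>' y \<ge> 0" if "y > z" for y
    proof (rule ccontr)
      assume "\<not> ?thesis"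
      then obtain d where d: "d > 0" "\<And>e. 0 < e \<Longrightarrow> e < d \<Longrightarrow> \<phi> y < \<phi> (y - e)"
        using DERIV_neg_dec_left[OF \<phi>'[of y]] by auto
      define e where "e = min (d/2) (y - z)"
      have "0 < e" "e < d" "z \<le> y - e" using d that by (auto simp: e_def)
      then show False using d(2)[of e] end_max[of y "y - e"] that z1 by auto
    qed
    define d where "d = \<phi> z * (\<phi> z / B - 1)"
    have d: "d > 0" using zB B1 pos[of z] by (simp add: d_def)
    have \<phi>''d: "\<phi>'' y \<ge> d" if "y > z" for y
    proof -
      have "\<phi> z \<le> \<phi> y" using end_max[of y z] that z1 by auto
      then have "d \<le> \<phi> y * (\<phi> y / B - 1)"
        unfolding d_def using zB B1 pos[of z] by (intro mult_mono diff_mono divide_right_mono) auto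
      also have "\<dots> \<le> \<phi>'' y - c * \<phi>' y" by (rule growth)
      also have "\<dots> \<le> \<phi>'' y" using \<phi>'_nonneg[OF that] c by simp
      finally show ?thesis .
    qed
    have "\<not> bdd_above (range \<phi>)"
    proof (rule not_bounded_if_derivative_ge[OF \<phi>' d])
      fix y assume y: "y \<ge> z + 2"
      then have yz: "z + 1 < y" by simp
      obtain \<xi> where \<xi>: "z + 1 < \<xi>" "\<phi>' y - \<phi>' (z + 1) = (y - (z + 1)) * \<phi>'' \<xi>"
        using MVT2[OF yz, of \<phi>' \<phi>''] \<phi>'' by auto
      have "d \<le> \<phi>'' \<xi>" using \<phi>''d[of \<xi>] \<xi> by simp
      also have "\<dots> \<le> (y - (z + 1)) * \<phi>'' \<xi>" using calculation d y by (simp add: mult_le_cancel_right1)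
      finally show "d \<le> \<phi>' y" using \<xi>(2) \<phi>'_nonneg[of "z + 1"] by simp
    qed
    then show False using wave by (simp add: traveling_wave_def)
  qed
  also have "B \<le> exp (c * h)"
  proof -
    have "l1 < 1"
    proof (rule ccontr)
      assume "\<not> l1 < 1"
      then have "l1 * l2 > 1" using roots by (smt (verit) mult_less_cancel_left1 mult_le_cancel_left1)
      then show False using chi0_factor(2)[OF roots(3,4,2)] by simp
    qed
    then show ?thesis using c h roots by (simp add: B_def mult_left_le_one_le)
  qed
  finally show ?thesis .
qed

section \<open>Comparison for solutions of the delayed equation\<close>

lemma kpp_equationD:
  assumes "kpp_equation h u" "t > 0"
  shows "\<exists>a p q. ((\<lambda>\<tau>. u \<tau> x) has_real_derivative a) (at t) \<and>
    (\<forall>y. (u t has_real_derivative p y) (at y)) \<and> (p has_real_derivative q) (at x) \<and>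
    a = q + u t x * (1 - u (t - h) x)"
proof -
  from assms obtain ut ux uxx where
    eq: "\<forall>t>0. \<forall>x. ((\<lambda>\<tau>. u \<tau> x) has_real_derivative ut t x) (at t) \<and>
        ((\<lambda>y. u t y) has_real_derivative ux t x) (at x) \<and>
        ((\<lambda>y. ux t y) has_real_derivative uxx t x) (at x) \<and>
        ut t x = uxx t x + u t x * (1 - u (t - h) x)"
    unfolding kpp_equation_def by blast
  show ?thesis
    by (rule exI[of _ "ut t x"], rule exI[of _ "ux t"], rule exI[of _ "uxx t x"])
      (use eq assms(2) in blast)
qed

lemma kpp_equation_translate:
  assumes "kpp_equation h u"
  shows "kpp_equation h (\<lambda>t x. u t (x + a))"
proof -
  from assms obtain ut ux uxx where
    eq: "\<forall>t>0. \<forall>x. ((\<lambda>\<tau>. u \<tau> x) has_real_derivative ut t x) (at t) \<and>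
        ((\<lambda>y. u t y) has_real_derivative ux t x) (at x) \<and>
        ((\<lambda>y. ux t y) has_real_derivative uxx t x) (at x) \<and>
        ut t x = uxx t x + u t x * (1 - u (t - h) x)"
    unfolding kpp_equation_def by blast
  have shift: "((\<lambda>y. f (y + a)) has_real_derivative d) (at x)"
    if "(f has_real_derivative d) (at (x + a))" for f :: "real \<Rightarrow> real" and d x
    using that DERIV_shift by blast
  show ?thesis
    unfolding kpp_equation_def
  proof (intro exI allI impI conjI)
    fix t x :: real
    assume t: "t > 0"
    show "((\<lambda>\<tau>. u \<tau> (x + a)) has_real_derivative ut t (x + a)) (at t)"
      using eq t by blast
    show "((\<lambda>y. u t (y + a)) has_real_derivative ux t (x + a)) (at x)"
      using eq t by (intro shift) blast
    show "((\<lambda>y. ux t (y + a)) has_real_derivative uxx t (x + a)) (at x)"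
      using eq t by (intro shift) blast
    show "ut t (x + a) = uxx t (x + a) + u t (x + a) * (1 - u (t - h) (x + a))"
      using eq t by blast
  qed
qed

lemma kpp_solution_nonneg:
  assumes h: "h \<ge> 0" and sol: "kpp_solution h u0 u"
    and u0_nonneg: "\<forall>s\<in>{-h..0}. \<forall>x. u0 s x \<ge> 0"
    and u0_bounded: "bounded ((\<lambda>(s, x). u0 s x) ` ({-h..0} \<times> UNIV))"
    and t: "t \<ge> -h"
  shows "u t x \<ge> 0"
proof (cases "t \<le> 0")
  case True
  then show ?thesis using sol u0_nonneg t by (auto simp: kpp_solution_def)
next
  case False
  have init: "u s y = u0 s y" if "s \<in> {-h..0}" for s y
    using sol that by (simp add: kpp_solution_def)
  have eq: "kpp_equation h u" using sol by (simp add: kpp_solution_def)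
  obtain U0 where U0: "\<And>s y. s \<in> {-h..0} \<Longrightarrow> \<bar>u0 s y\<bar> \<le> U0"
    using u0_bounded unfolding bounded_iff by fastforce
  obtain U1 where U1: "\<And>s y. s \<in> {0..t} \<Longrightarrow> \<bar>u s y\<bar> \<le> U1"
    using sol unfolding kpp_solution_def bounded_iff by fastforce
  have U: "\<bar>u s y\<bar> \<le> max U0 U1" if "-h \<le> s" "s \<le> t" for s y
    using U0[of s y] U1[of s y] init[of s y] that by (cases "s \<le> 0") (auto simp: max_def)
  have "- u t x \<le> 0"
  proof (rule parabolic_maximum_principle[where W = "\<lambda>t x. - u t x" and T = t and B = U1
        and k = "1 + max U0 U1"])
    show "continuous_on ({0..t} \<times> UNIV) (\<lambda>(t, x). - u t x)"
    proof -
      have "continuous_on ({0..t} \<times> UNIV) (\<lambda>(t, x). u t x)"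
        by (rule continuous_on_subset[of "{0..} \<times> UNIV"])
           (use sol in \<open>auto simp: kpp_solution_def\<close>)
      then show ?thesis unfolding case_prod_beta' by (rule continuous_on_minus)
    qed
    show "- u s y \<le> U1" if "0 \<le> s" "s \<le> t" for s y using U1[of s y] that by auto
    show "- u 0 y \<le> 0" for y using init[of 0 y] u0_nonneg h by simp
    fix s y assume s: "0 < s" "s \<le> t" and pos: "- u s y > 0"
    obtain a p q where d: "((\<lambda>\<tau>. u \<tau> y) has_real_derivative a) (at s)"
      "\<forall>y. (u s has_real_derivative p y) (at y)" "(p has_real_derivative q) (at y)"
      "a = q + u s y * (1 - u (s - h) y)"
      using kpp_equationD[OF eq s(1)] by blast
    have "(- u s y) * (1 - u (s - h) y) \<le> (- u s y) * (1 + max U0 U1)"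
      using pos U[of "s - h" y] s h by (intro mult_left_mono) auto
    then have le: "- a \<le> - q + (1 + max U0 U1) * - u s y"
      unfolding d(4) by (simp add: algebra_simps)
    show "\<exists>a p q. ((\<lambda>\<tau>. - u \<tau> y) has_real_derivative a) (at s) \<and>
        (\<forall>y. ((\<lambda>x. - u s x) has_real_derivative p y) (at y)) \<and>
        (p has_real_derivative q) (at y) \<and> a \<le> q + (1 + max U0 U1) * - u s y"
      by (rule exI[of _ "- a"], rule exI[of _ "\<lambda>y. - p y"], rule exI[of _ "- q"])
        (use d(1-3) le in \<open>simp add: DERIV_minus\<close>)
  qed (use False in auto)
  then show ?thesis by simp
qed

text \<open>
  For nonnegative solutions \<open>u_t \<le> u_xx + u\<close>, and \<open>exp (l (x + c t))\<close> solves the corresponding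
  equation exactly when \<open>l\<close> is a zero of \<open>chi0 c\<close>.
\<close>

lemma kpp_solution_exp_bound:
  assumes sol: "kpp_solution h u0 u"
    and nonneg: "\<And>t x. t \<ge> -h \<Longrightarrow> u t x \<ge> 0"
    and root: "chi0 c l = 0"
    and C: "C \<ge> 0" and init: "\<And>x. u 0 x \<le> C * exp (l * x)"
    and h: "h \<ge> 0" and t: "t \<ge> 0"
  shows "u t x \<le> C * exp (l * (x + c * t))"
proof -
  have eq: "kpp_equation h u" using sol by (simp add: kpp_solution_def)
  define E where "E = (\<lambda>t x. C * exp (l * (x + c * t)))"
  have E0: "E s y \<ge> 0" for s y using C by (simp add: E_def)
  obtain U1 where U1: "\<And>s y. s \<in> {0..t} \<Longrightarrow> \<bar>u s y\<bar> \<le> U1"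
    using sol unfolding kpp_solution_def bounded_iff by fastforce
  have "u t x - E t x \<le> 0"
  proof (rule parabolic_maximum_principle[where W = "\<lambda>t x. u t x - E t x" and T = t and B = U1
        and k = 1])
    show "continuous_on ({0..t} \<times> UNIV) (\<lambda>(t, x). u t x - E t x)"
    proof -
      have "continuous_on ({0..t} \<times> UNIV) (\<lambda>(t, x). u t x)"
        by (rule continuous_on_subset[of "{0..} \<times> UNIV"])
           (use sol in \<open>auto simp: kpp_solution_def\<close>)
      then show ?thesis unfolding case_prod_beta' E_def by (intro continuous_intros)
    qed
    show "u s y - E s y \<le> U1" if "0 \<le> s" "s \<le> t" for s y
      using U1[of s y] E0[of s y] that by auto
    show "u 0 y - E 0 y \<le> 0" for y using init[of y] by (simp add: E_def)
    fix s y assume s: "0 < s" "s \<le> t" and pos: "u s y - E s y > 0"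
    obtain a p q where d: "((\<lambda>\<tau>. u \<tau> y) has_real_derivative a) (at s)"
      "\<And>y. (u s has_real_derivative p y) (at y)" "(p has_real_derivative q) (at y)"
      "a = q + u s y * (1 - u (s - h) y)"
      using kpp_equationD[OF eq s(1)] by blast
    have Et: "((\<lambda>\<tau>. E \<tau> y) has_real_derivative l * c * E s y) (at s)"
      unfolding E_def by (auto intro!: derivative_eq_intros simp: algebra_simps)
    have Ex: "(E s has_real_derivative l * E s y) (at y)" for y
      unfolding E_def by (auto intro!: derivative_eq_intros)
    have Exx: "((\<lambda>y. l * E s y) has_real_derivative l * (l * E s y)) (at y)"
      by (intro DERIV_cmult Ex)
    have "u s y * (1 - u (s - h) y) \<le> u s y"
      using nonneg[of s y] nonneg[of "s - h" y] s h by (simp add: algebra_simps)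
    then have "a \<le> q + u s y" unfolding d(4) by linarith
    moreover have "l * c = l * l + 1" using root by (simp add: chi0_def power2_eq_square mult.commute)
    then have "l * c * E s y = l * (l * E s y) + E s y" by (simp add: distrib_right)
    ultimately have le: "a - l * c * E s y \<le> q - l * (l * E s y) + 1 * (u s y - E s y)"
      by simp
    show "\<exists>a p q. ((\<lambda>\<tau>. u \<tau> y - E \<tau> y) has_real_derivative a) (at s) \<and>
        (\<forall>y. ((\<lambda>x. u s x - E s x) has_real_derivative p y) (at y)) \<and>
        (p has_real_derivative q) (at y) \<and> a \<le> q + 1 * (u s y - E s y)"
      by (intro exI conjI allI) (rule DERIV_diff[OF d(1) Et] DERIV_diff[OF d(2) Ex]
          DERIV_diff[OF d(3) Exx] le)+
  qed (use t in auto)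
  then show ?thesis by (simp add: E_def)
qed

text \<open>
  Applied to \<open>\<sigma> (u - v) - S\<close> with either sign \<open>\<sigma>\<close>, the maximum principle needs the differential
  inequality only where \<open>\<sigma> (u - v) > S \<ge> 0\<close>. There the factor \<open>1 - u (t - h)\<close> may be replaced
  by one. The delay term is estimated in absolute value if \<open>h > 0\<close>; if \<open>h = 0\<close> it has a favourable
  sign. For \<open>h > 0\<close> the hypothesis on the delay term involves the unknown difference, but only at
  earlier times, which is what allows an argument in steps of length \<open>h\<close>.
\<close>

lemma perturbation_comparison:
  fixes u v S :: "real \<Rightarrow> real \<Rightarrow> real"
  assumes h: "h \<ge> 0"
    and equ: "kpp_equation h u" and eqv: "kpp_equation h v"
    and u_nonneg: "\<And>t x. t \<ge> -h \<Longrightarrow> u t x \<ge> 0"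
    and v_nonneg: "\<And>t x. t \<ge> -h \<Longrightarrow> v t x \<ge> 0"
    and cont: "continuous_on ({0..T} \<times> UNIV) (\<lambda>(t, x). u t x)"
      "continuous_on ({0..T} \<times> UNIV) (\<lambda>(t, x). v t x)"
      "continuous_on ({0..T} \<times> UNIV) (\<lambda>(t, x). S t x)"
    and bdd: "\<And>t x. 0 \<le> t \<Longrightarrow> t \<le> T \<Longrightarrow> u t x \<le> B"
      "\<And>t x. 0 \<le> t \<Longrightarrow> t \<le> T \<Longrightarrow> v t x \<le> B"
    and St: "\<And>t x. ((\<lambda>\<tau>. S \<tau> x) has_real_derivative St t x) (at t)"
    and Sx: "\<And>t x. (S t has_real_derivative Sx t x) (at x)"
    and Sxx: "\<And>t x. (Sx t has_real_derivative Sxx t x) (at x)"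
    and S_nonneg: "\<And>t x. S t x \<ge> 0"
    and init: "\<And>x. \<bar>u 0 x - v 0 x\<bar> \<le> S 0 x"
    and super0: "\<And>t x. 0 < t \<Longrightarrow> t \<le> T \<Longrightarrow> 0 \<le> St t x - Sxx t x - S t x"
    and super: "\<And>t x. h > 0 \<Longrightarrow> 0 < t \<Longrightarrow> t \<le> T \<Longrightarrow>
      v t x * \<bar>u (t - h) x - v (t - h) x\<bar> \<le> St t x - Sxx t x - S t x"
    and t: "0 \<le> t" "t \<le> T"
  shows "\<bar>u t x - v t x\<bar> \<le> S t x"
proof -
  have signed: "\<sigma> * (u t x - v t x) - S t x \<le> 0" if \<sigma>: "\<sigma> = 1 \<or> \<sigma> = -1" for \<sigma> :: real
  proof (rule parabolic_maximum_principle[where T = T and B = B and k = 1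
        and W = "\<lambda>t x. \<sigma> * (u t x - v t x) - S t x"])
    show "continuous_on ({0..T} \<times> UNIV) (\<lambda>(t, x). \<sigma> * (u t x - v t x) - S t x)"
      using cont unfolding case_prod_beta' by (intro continuous_intros)
    show "\<sigma> * (u s y - v s y) - S s y \<le> B" if "0 \<le> s" "s \<le> T" for s y
    proof -
      have "\<sigma> * (u s y - v s y) \<le> B"
        using \<sigma> bdd[OF that, of y] u_nonneg[of s y] v_nonneg[of s y] h that by auto
      then show ?thesis using S_nonneg[of s y] by simp
    qed
    show "\<sigma> * (u 0 y - v 0 y) - S 0 y \<le> 0" for y using init[of y] \<sigma> by auto
    fix s y assume s: "0 < s" "s \<le> T" and pos: "\<sigma> * (u s y - v s y) - S s y > 0"
    obtain a p q where d: "((\<lambda>\<tau>. u \<tau> y) has_real_derivative a) (at s)"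
      "\<And>y. (u s has_real_derivative p y) (at y)" "(p has_real_derivative q) (at y)"
      "a = q + u s y * (1 - u (s - h) y)"
      using kpp_equationD[OF equ s(1)] by blast
    obtain a' p' q' where d': "((\<lambda>\<tau>. v \<tau> y) has_real_derivative a') (at s)"
      "\<And>y. (v s has_real_derivative p' y) (at y)" "(p' has_real_derivative q') (at y)"
      "a' = q' + v s y * (1 - v (s - h) y)"
      using kpp_equationD[OF eqv s(1)] by blast
    define \<delta> where "\<delta> = \<sigma> * (u s y - v s y)"
    define \<delta>h where "\<delta>h = \<sigma> * (u (s - h) y - v (s - h) y)"
    have \<delta>pos: "\<delta> > 0" using pos S_nonneg[of s y] by (simp add: \<delta>_def)
    have split: "\<sigma> * (a - a') = \<sigma> * (q - q') + \<delta> * (1 - u (s - h) y) - v s y * \<delta>h"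
      unfolding d(4) d'(4) \<delta>_def \<delta>h_def by (simp add: algebra_simps)
    have "\<delta> * (1 - u (s - h) y) \<le> \<delta>"
      using \<delta>pos u_nonneg[of "s - h" y] s by (simp add: algebra_simps)
    moreover have "- (v s y * \<delta>h) \<le> St s y - Sxx s y - S s y"
    proof (cases "h = 0")
      case True
      then have "v s y * \<delta>h \<ge> 0"
        using \<delta>pos v_nonneg[of s y] s by (simp add: \<delta>_def \<delta>h_def)
      then show ?thesis using super0[OF s, of y] by linarith
    next
      case False
      have "- (v s y * \<delta>h) = v s y * (- \<delta>h)" by simp
      also have "\<dots> \<le> v s y * \<bar>u (s - h) y - v (s - h) y\<bar>"
        using v_nonneg[of s y] s h \<sigma> by (intro mult_left_mono) (auto simp: \<delta>h_def)
      also have "\<dots> \<le> St s y - Sxx s y - S s y" using super[of s y] s h False by simp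
      finally show ?thesis .
    qed
    ultimately have le: "\<sigma> * (a - a') - St s y
        \<le> \<sigma> * (q - q') - Sxx s y + 1 * (\<sigma> * (u s y - v s y) - S s y)"
      unfolding split by (simp add: \<delta>_def)
    show "\<exists>a p q. ((\<lambda>\<tau>. \<sigma> * (u \<tau> y - v \<tau> y) - S \<tau> y) has_real_derivative a) (at s) \<and>
        (\<forall>y. ((\<lambda>x. \<sigma> * (u s x - v s x) - S s x) has_real_derivative p y) (at y)) \<and>
        (p has_real_derivative q) (at y) \<and> a \<le> q + 1 * (\<sigma> * (u s y - v s y) - S s y)"
      by (intro exI conjI allI) (rule DERIV_diff[OF DERIV_cmult[OF DERIV_diff[OF d(1) d'(1)]] St]
          DERIV_diff[OF DERIV_cmult[OF DERIV_diff[OF d(2) d'(2)]] Sx]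
          DERIV_diff[OF DERIV_cmult[OF DERIV_diff[OF d(3) d'(3)]] Sxx] le)+
  qed (use t in auto)
  show ?thesis using signed[of 1] signed[of "-1"] by (simp add: abs_le_iff)
qed

text \<open>
  The residual of \<open>S = Q exp (\<gamma> t) (exp (\<mu> z) + A exp (\<nu> z))\<close> in the equation without delay is at least
  \<open>\<kappa>\<close> times the first term plus \<open>\<kappa> + M exp (- \<nu> c h - \<gamma> h)\<close> times the second one. The delayed second term
  consumes the multiple \<open>M exp (- \<nu> c h - \<gamma> h)\<close>; the delayed first term is paid for by the multiples \<open>\<kappa>\<close> of
  both, by hypothesis \<open>tail\<close>. On the first delay interval the past of the difference is
  not controlled by \<open>S\<close>, and hypothesis \<open>layer\<close> takes the place of this estimate; after that,
  induction over intervals of length \<open>h\<close> works.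
\<close>

lemma perturbation_weighted_decay:
  fixes u v :: "real \<Rightarrow> real \<Rightarrow> real"
  assumes h: "h \<ge> 0"
    and equ: "kpp_equation h u" and eqv: "kpp_equation h v"
    and u_nonneg: "\<And>t x. t \<ge> -h \<Longrightarrow> u t x \<ge> 0"
    and v_nonneg: "\<And>t x. t \<ge> -h \<Longrightarrow> v t x \<ge> 0"
    and cont: "continuous_on ({0..} \<times> UNIV) (\<lambda>(t, x). u t x)"
      "continuous_on ({0..} \<times> UNIV) (\<lambda>(t, x). v t x)"
    and bdd: "\<And>T. bounded ((\<lambda>(t, x). u t x) ` ({0..T} \<times> UNIV))"
    and vM: "\<And>t x. v t x \<le> M"
    and par: "\<gamma> \<le> 0" "\<kappa> > 0" "A \<ge> 0" "Q \<ge> 0"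
    and rate\<mu>: "\<kappa> \<le> \<gamma> - chi0 c \<mu>"
    and rate\<nu>: "M * exp (- \<nu> * c * h - \<gamma> * h) + \<kappa> \<le> \<gamma> - chi0 c \<nu>"
    and tail: "\<And>t x. v t x * exp (- \<mu> * c * h - \<gamma> * h) \<le> \<kappa> * (1 + A * exp ((\<nu> - \<mu>) * (x + c * t)))"
    and init: "\<And>x. \<bar>u 0 x - v 0 x\<bar> \<le> Q * exp (\<mu> * x)"
    and layer: "\<And>t x. 0 < t \<Longrightarrow> t \<le> h \<Longrightarrow>
      v t x * \<bar>u (t - h) x - v (t - h) x\<bar> \<le> Q * exp (\<gamma> * h) * \<kappa> * exp (\<mu> * (x + c * t))"
    and t: "t \<ge> 0"
  shows "\<bar>u t x - v t x\<bar> \<le> Q * exp (\<gamma> * t) * (exp (\<mu> * (x + c * t)) + A * exp (\<nu> * (x + c * t)))"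
proof -
  define e where "e = (\<lambda>r t x. Q * exp (\<gamma> * t) * exp (r * (x + c * t)))"
  define S where "S = (\<lambda>t x. e \<mu> t x + A * e \<nu> t x)"
  define St where "St = (\<lambda>t x. (\<gamma> + \<mu> * c) * e \<mu> t x + A * ((\<gamma> + \<nu> * c) * e \<nu> t x))"
  define Sx where "Sx = (\<lambda>t x. \<mu> * e \<mu> t x + A * (\<nu> * e \<nu> t x))"
  define Sxx where "Sxx = (\<lambda>t x. \<mu> * (\<mu> * e \<mu> t x) + A * (\<nu> * (\<nu> * e \<nu> t x)))"
  have et: "((\<lambda>\<tau>. e r \<tau> y) has_real_derivative (\<gamma> + r * c) * e r s y) (at s)" for r s y
    unfolding e_def by (auto intro!: derivative_eq_intros simp: algebra_simps)
  have ex: "(e r s has_real_derivative r * e r s y) (at y)" for r s y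
    unfolding e_def by (auto intro!: derivative_eq_intros)
  have e0: "e r s y \<ge> 0" for r s y using par by (simp add: e_def)
  have St: "((\<lambda>\<tau>. S \<tau> y) has_real_derivative St s y) (at s)" for s y
    unfolding S_def St_def by (intro DERIV_add DERIV_cmult et)
  have Sx: "(S s has_real_derivative Sx s y) (at y)" for s y
    unfolding S_def Sx_def by (intro DERIV_add DERIV_cmult ex)
  have Sxx: "(Sx s has_real_derivative Sxx s y) (at y)" for s y
    unfolding Sx_def Sxx_def by (intro DERIV_add DERIV_cmult ex)
  have S0: "S s y \<ge> 0" for s y using e0 par by (simp add: S_def)
  have M: "M \<ge> 0" using vM[of 0 0] v_nonneg[of 0 0] h by simp
  have residual: "\<kappa> * e \<mu> s y + A * ((M * exp (- \<nu> * c * h - \<gamma> * h) + \<kappa>) * e \<nu> s y)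
      \<le> St s y - Sxx s y - S s y" for s y
  proof -
    have "St s y - Sxx s y - S s y
        = (\<gamma> - chi0 c \<mu>) * e \<mu> s y + A * ((\<gamma> - chi0 c \<nu>) * e \<nu> s y)"
      by (simp add: St_def Sxx_def S_def chi0_def power2_eq_square algebra_simps)
    moreover have "\<kappa> * e \<mu> s y \<le> (\<gamma> - chi0 c \<mu>) * e \<mu> s y"
      using rate\<mu> e0 by (rule mult_right_mono)
    moreover have "A * ((M * exp (- \<nu> * c * h - \<gamma> * h) + \<kappa>) * e \<nu> s y)
        \<le> A * ((\<gamma> - chi0 c \<nu>) * e \<nu> s y)"
      using rate\<nu> e0 par by (intro mult_left_mono mult_right_mono) auto
    ultimately show ?thesis by linarith
  qed
  have residual0: "0 \<le> St s y - Sxx s y - S s y" for s y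
    using residual[of s y] e0 par M by (smt (verit) exp_ge_zero mult_nonneg_nonneg)
  have delay_e: "e r (s - h) y = exp (- r * c * h - \<gamma> * h) * e r s y" for r s y
    by (simp add: e_def exp_add[symmetric] mult.assoc mult.left_commute[of _ Q] algebra_simps)
  have super_late: "v s y * S (s - h) y \<le> St s y - Sxx s y - S s y" if "s \<ge> 0" for s y
  proof -
    have v0: "v s y \<ge> 0" using v_nonneg that h by simp
    have "v s y * e \<mu> (s - h) y = (v s y * exp (- \<mu> * c * h - \<gamma> * h)) * e \<mu> s y"
      unfolding delay_e by simp
    also have "\<dots> \<le> (\<kappa> * (1 + A * exp ((\<nu> - \<mu>) * (y + c * s)))) * e \<mu> s y"
      by (rule mult_right_mono[OF tail e0])
    also have "\<dots> = \<kappa> * e \<mu> s y + A * (\<kappa> * (exp ((\<nu> - \<mu>) * (y + c * s)) * e \<mu> s y))"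
      by (simp add: algebra_simps)
    also have "exp ((\<nu> - \<mu>) * (y + c * s)) * e \<mu> s y = e \<nu> s y"
      by (simp add: e_def exp_add[symmetric] mult.left_commute[of _ Q] algebra_simps)
    finally have 1: "v s y * e \<mu> (s - h) y \<le> \<kappa> * e \<mu> s y + A * (\<kappa> * e \<nu> s y)" .
    have "v s y * e \<nu> (s - h) y = v s y * (exp (- \<nu> * c * h - \<gamma> * h) * e \<nu> s y)"
      unfolding delay_e ..
    also have "\<dots> \<le> M * (exp (- \<nu> * c * h - \<gamma> * h) * e \<nu> s y)"
      using vM e0 by (intro mult_right_mono mult_nonneg_nonneg) auto
    finally have "A * (v s y * e \<nu> (s - h) y) \<le> A * (M * (exp (- \<nu> * c * h - \<gamma> * h) * e \<nu> s y))"
      using par by (intro mult_left_mono) auto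
    with 1 have "v s y * S (s - h) y
        \<le> \<kappa> * e \<mu> s y + A * ((M * exp (- \<nu> * c * h - \<gamma> * h) + \<kappa>) * e \<nu> s y)"
      by (simp add: S_def algebra_simps)
    also note residual
    finally show ?thesis .
  qed
  have super_layer: "v s y * \<bar>u (s - h) y - v (s - h) y\<bar> \<le> St s y - Sxx s y - S s y"
    if s: "0 < s" "s \<le> h" for s y
  proof -
    have "v s y * \<bar>u (s - h) y - v (s - h) y\<bar> \<le> Q * exp (\<gamma> * h) * \<kappa> * exp (\<mu> * (y + c * s))"
      by (rule layer[OF s])
    also have "\<dots> \<le> Q * exp (\<gamma> * s) * \<kappa> * exp (\<mu> * (y + c * s))"
      using par s by (intro mult_right_mono mult_left_mono) (auto simp: mult_left_mono_neg)
    also have "\<dots> = \<kappa> * e \<mu> s y" by (simp add: e_def)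
    also have "\<dots> \<le> \<kappa> * e \<mu> s y + A * ((M * exp (- \<nu> * c * h - \<gamma> * h) + \<kappa>) * e \<nu> s y)"
      using par M e0 by simp
    also note residual
    finally show ?thesis .
  qed
  have extend: "\<bar>u s y - v s y\<bar> \<le> S s y"
    if past: "\<And>s y. h > 0 \<Longrightarrow> h < s \<Longrightarrow> s \<le> T \<Longrightarrow> \<bar>u (s - h) y - v (s - h) y\<bar> \<le> S (s - h) y"
      and s: "0 \<le> s" "s \<le> T" for T s y
  proof -
    obtain B where B: "\<And>s y. s \<in> {0..T} \<Longrightarrow> \<bar>u s y\<bar> \<le> B"
      using bdd[of T] unfolding bounded_iff by fastforce
    show ?thesis
    proof (rule perturbation_comparison[where u = u and v = v and S = S and h = h and T = T
          and B = "max B M" and St = St and Sx = Sx and Sxx = Sxx])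
      show "continuous_on ({0..T} \<times> UNIV) (\<lambda>(t, x). u t x)"
        "continuous_on ({0..T} \<times> UNIV) (\<lambda>(t, x). v t x)"
        by (rule continuous_on_subset[of "{0..} \<times> UNIV"], use cont in auto)+
      show "continuous_on ({0..T} \<times> UNIV) (\<lambda>(t, x). S t x)"
        unfolding S_def e_def case_prod_beta' by (intro continuous_intros)
      show "u s y \<le> max B M" if "0 \<le> s" "s \<le> T" for s y
        using B[of s y] that by (auto simp: max_def)
      show "v s y \<le> max B M" for s y using vM[of s y] by simp
      show "\<bar>u 0 y - v 0 y\<bar> \<le> S 0 y" for y
        using init[of y] e0[of \<nu> 0 y] par by (simp add: S_def e_def add_increasing2)
      show "v s y * \<bar>u (s - h) y - v (s - h) y\<bar> \<le> St s y - Sxx s y - S s y"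
        if "h > 0" "0 < s" "s \<le> T" for s y
      proof (cases "s \<le> h")
        case True
        then show ?thesis using super_layer that by simp
      next
        case False
        have "v s y * \<bar>u (s - h) y - v (s - h) y\<bar> \<le> v s y * S (s - h) y"
          using past[of s y] that False v_nonneg[of s y] h by (intro mult_left_mono) auto
        also note super_late
        finally show ?thesis using that by simp
      qed
    qed (use h equ eqv u_nonneg v_nonneg St Sx Sxx S0 residual0 s in auto)
  qed
  have "\<bar>u t x - v t x\<bar> \<le> S t x"
  proof (cases "h = 0")
    case True
    then show ?thesis using extend[of t t x] t by simp
  next
    case False
    have steps: "\<forall>s y. 0 \<le> s \<longrightarrow> s \<le> real n * h \<longrightarrow> \<bar>u s y - v s y\<bar> \<le> S s y" for n
    proof (induction n)
      case 0
      have "\<bar>u 0 y - v 0 y\<bar> \<le> S 0 y" for y using extend[of 0 0 y] h by simp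
      then show ?case by (metis mult_zero_left of_nat_0 order_antisym)
    next
      case (Suc n)
      show ?case
      proof (intro allI impI)
        fix s y assume s: "0 \<le> s" "s \<le> real (Suc n) * h"
        show "\<bar>u s y - v s y\<bar> \<le> S s y"
        proof (rule extend[OF _ s])
          fix s y assume "h > 0" "h < s" "s \<le> real (Suc n) * h"
          then show "\<bar>u (s - h) y - v (s - h) y\<bar> \<le> S (s - h) y"
            using Suc.IH by (simp add: algebra_simps)
        qed
      qed
    qed
    obtain n where "t < real n * h" using reals_Archimedean3[of h] h False by auto
    then show ?thesis using steps[of n] t by auto
  qed
  then show ?thesis by (simp add: S_def e_def distrib_left mult.left_commute)
qed

section \<open>Stability of the wave\<close>

text \<open>
  The device by which a bound at minus infinity, combined with plain boundedness, is converted into a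
  global bound with a smaller exponent.
\<close>

lemma le_exp_of_le_steeper_exp_and_const:
  fixes y :: real
  assumes "y \<le> C * exp (a * z)" "y \<le> C" "C \<ge> 0" "0 \<le> b" "b \<le> a"
  shows "y \<le> C * exp (b * z)"
proof (cases "z \<le> 0")
  case True
  then have "exp (a * z) \<le> exp (b * z)" using assms by (simp add: mult_right_mono_neg)
  then show ?thesis using assms by (smt (verit) mult_left_mono)
next
  case False
  then have "1 \<le> exp (b * z)" using assms by simp
  then have "C * 1 \<le> C * exp (b * z)" using assms by (intro mult_left_mono)
  then show ?thesis using assms by simp
qed

lemma wave_le_exp:
  assumes asymp: "wave_asymptotics l1 l2 \<phi>" and M: "\<And>z. \<phi> z \<le> M" "M \<ge> 0" and l1: "l1 > 0"
  obtains C where "C > 0" "\<And>z. \<phi> z \<le> C * exp (l1 * z)"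
proof -
  obtain a \<sigma> r1 where \<sigma>: "\<sigma> > 0" and r1: "bounded (range r1)"
    and as: "\<And>t. \<phi> (t + a) = exp (l1 * t) + exp ((l1 + \<sigma>) * t) * r1 t"
    using asymp unfolding wave_asymptotics_def by blast
  obtain B where B: "\<And>t. \<bar>r1 t\<bar> \<le> B" using r1 unfolding bounded_iff by auto
  have B0: "B \<ge> 0" using B[of 0] by simp
  have left: "\<phi> (t + a) \<le> (1 + B + M) * exp (l1 * t)" for t
  proof (cases "t \<le> 0")
    case True
    have "exp ((l1 + \<sigma>) * t) * r1 t \<le> exp ((l1 + \<sigma>) * t) * B"
      using B[of t] by (intro mult_left_mono) auto
    also have "\<dots> \<le> exp (l1 * t) * B"
      using True \<sigma> B0 by (intro mult_right_mono) (auto simp: distrib_right mult_nonneg_nonpos)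
    finally have "\<phi> (t + a) \<le> (1 + B) * exp (l1 * t)" unfolding as by (simp add: algebra_simps)
    also have "\<dots> \<le> (1 + B + M) * exp (l1 * t)" using M by simp
    finally show ?thesis .
  next
    case False
    have "\<phi> (t + a) \<le> (1 + B + M) * 1" using M(1)[of "t + a"] B0 by simp
    also have "\<dots> \<le> (1 + B + M) * exp (l1 * t)"
      using False l1 B0 M by (intro mult_left_mono) auto
    finally show ?thesis .
  qed
  show ?thesis
  proof
    show "(1 + B + M) * exp (- (l1 * a)) > 0" using B0 M by (simp add: add_pos_nonneg)
    show "\<phi> z \<le> (1 + B + M) * exp (- (l1 * a)) * exp (l1 * z)" for z
      using left[of "z - a"] by (simp add: mult.assoc exp_add[symmetric] algebra_simps)
  qed
qed

lemma le_interpolated_exp: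
  fixes y :: real
  assumes "y \<le> N * exp a" "y \<le> N * exp b" "N \<ge> 0" "0 \<le> \<theta>" "\<theta> \<le> 1"
  shows "y \<le> N * exp (\<theta> * a + (1 - \<theta>) * b)"
proof -
  have "min a b \<le> \<theta> * a + (1 - \<theta>) * b"
  proof -
    have "\<theta> * min a b \<le> \<theta> * a" "(1 - \<theta>) * min a b \<le> (1 - \<theta>) * b"
      using assms by (auto intro!: mult_left_mono)
    then show ?thesis by (simp add: algebra_simps)
  qed
  then have "N * exp (min a b) \<le> N * exp (\<theta> * a + (1 - \<theta>) * b)"
    using assms by (intro mult_left_mono) auto
  then show ?thesis using assms by (auto simp: min_def split: if_splits)
qed

theorem corollary1p5:
  fixes h c l1 l2 lstar K :: real
    and \<phi> \<alpha>0 :: "real \<Rightarrow> real"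
    and u0 u :: "real \<Rightarrow> real \<Rightarrow> real"
  assumes dom: "(h, c) \<in> kpp_domain"
    and roots: "0 < l1" "l1 < l2" "chi0 c l1 = 0" "chi0 c l2 = 0"
    and wave: "traveling_wave h c \<phi>"
    and asymp: "wave_asymptotics l1 l2 \<phi>"
    and u0_nonneg: "\<forall>s\<in>{-h..0}. \<forall>x. u0 s x \<ge> 0"
    and u0_bounded: "bounded ((\<lambda>(s, x). u0 s x) ` ({-h..0} \<times> UNIV))"
    and u0_lipschitz: "\<exists>L. \<forall>s\<in>{-h..0}. L-lipschitz_on UNIV (u0 s)"
    and sol: "kpp_solution h u0 u"
    and lstar_gt: "lstar > l1"
    and K: "K > 0"
    and alpha: "continuous_on {-h..0} \<alpha>0"
    and close: "\<forall>s\<in>{-h..0}. \<forall>x. \<bar>u0 s x - \<phi> (x + c * s + \<alpha>0 s)\<bar> \<le> K * exp (lstar * x)"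
  shows "\<exists>\<mu> \<gamma> Q. l1 < \<mu> \<and> \<mu> < 2 * l1 \<and> \<gamma> < 0 \<and> Q \<ge> K \<and>
    (\<forall>x. \<forall>t\<ge>0. \<bar>u t x - \<phi> (x + c * t + \<alpha>0 0)\<bar> \<le> Q * exp (\<mu> * (x + c * t)) * exp (\<gamma> * t))"
proof -
  have h: "h \<ge> 0" and c: "c > 0" using dom by (auto simp: kpp_domain_def)
  define M where "M = exp (c * h)"
  have M0: "M > 0" by (simp add: M_def)
  have \<phi>pos: "\<phi> z > 0" for z using wave by (simp add: traveling_wave_def)
  have \<phi>M: "\<phi> z \<le> M" for z unfolding M_def by (rule wave_profile_le[OF wave c h roots])
  obtain C where C: "C > 0" and \<phi>C: "\<And>z. \<phi> z \<le> C * exp (l1 * z)"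
    using wave_le_exp[OF asymp \<phi>M _ roots(1)] M0 by auto
  obtain \<nu> where \<nu>: "chi0 c \<nu> + M * exp (- \<nu> * c * h) < 0"
  proof -
    obtain l where l: "l\<^sup>2 - c * l + 1 + exp (- l * c * h + c * h) < 0"
      using dom by (auto simp: kpp_domain_def)
    have "exp (- l * c * h + c * h) = M * exp (- l * c * h)"
      unfolding M_def exp_add by (rule mult.commute)
    with l have "chi0 c l + M * exp (- l * c * h) < 0" by (simp add: chi0_def)
    then show ?thesis by (rule that)
  qed
  have chi: "chi0 c z = (z - l1) * (z - l2)" for z by (rule chi0_factor(3)[OF roots(3,4,2)])
  have "(\<nu> - l1) * (\<nu> - l2) < 0"
    using \<nu> M0 unfolding chi[symmetric] by (smt (verit) exp_gt_zero mult_pos_pos)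
  then have \<nu>l: "l1 < \<nu>" "\<nu> < l2" using roots by (auto simp: mult_less_0_iff)
  \<comment> \<open>The three upper bounds on \<open>\<mu>\<close> serve the delayed initial layer, the initial value at time zero,
    and the final interpolation, respectively; the last one also gives \<open>chi0 c \<mu> < 0\<close>.\<close>
  obtain \<mu> where \<mu>: "l1 < \<mu>" "\<mu> < min (min (2 * l1) lstar) \<nu>"
    using dense[of l1 "min (min (2 * l1) lstar) \<nu>"] roots lstar_gt \<nu>l by auto
  have \<mu>chi: "chi0 c \<mu> < 0" unfolding chi using \<mu> \<nu>l by (simp add: mult_less_0_iff)

  obtain \<gamma> \<kappa> where \<gamma>: "\<gamma> < 0" and \<kappa>: "\<kappa> > 0" and rate\<mu>: "\<kappa> \<le> \<gamma> - chi0 c \<mu>"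
    and rate\<nu>: "M * exp (- \<nu> * c * h - \<gamma> * h) + \<kappa> \<le> \<gamma> - chi0 c \<nu>"
  proof -
    define f where "f = (\<lambda>g. g - chi0 c \<nu> - M * exp (- \<nu> * c * h - g * h))"
    have "(f \<longlongrightarrow> f 0) (at_left 0)" unfolding f_def by (intro tendsto_intros)
    moreover have "f 0 > 0" using \<nu> by (simp add: f_def)
    ultimately have "eventually (\<lambda>g. f g > 0) (at_left 0)" by (rule order_tendstoD)
    moreover have "((\<lambda>g. g - chi0 c \<mu>) \<longlongrightarrow> 0 - chi0 c \<mu>) (at_left 0)"
      by (intro tendsto_intros)
    then have "eventually (\<lambda>g. g - chi0 c \<mu> > 0) (at_left 0)"
      using \<mu>chi by (intro order_tendstoD) auto
    ultimately have "eventually (\<lambda>g. f g > 0 \<and> g - chi0 c \<mu> > 0) (at_left 0)"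
      by (rule eventually_conj)
    then obtain b where b: "b < 0" "\<And>g. b < g \<Longrightarrow> g < 0 \<Longrightarrow> f g > 0 \<and> g - chi0 c \<mu> > 0"
      unfolding eventually_at_left_field by blast
    define g where "g = b / 2"
    have g: "g < 0" "f g > 0" "g - chi0 c \<mu> > 0" using b(1) b(2)[of g] by (auto simp: g_def)
    show ?thesis
    proof (rule that[of g "min (f g) (g - chi0 c \<mu>)"])
      show "M * exp (- \<nu> * c * h - g * h) + min (f g) (g - chi0 c \<mu>) \<le> g - chi0 c \<nu>"
        by (simp add: f_def)
    qed (use g in auto)
  qed

  define v where "v = (\<lambda>t x. \<phi> (x + \<alpha>0 0 + c * t))"
  have equ: "kpp_equation h u" using sol by (simp add: kpp_solution_def)
  have eqv: "kpp_equation h v"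
    unfolding v_def
    using kpp_equation_translate[of h "\<lambda>t x. \<phi> (x + c * t)" "\<alpha>0 0"] wave
    by (simp add: traveling_wave_def)
  have u_nonneg: "u t x \<ge> 0" if "t \<ge> -h" for t x
    by (rule kpp_solution_nonneg[OF h sol u0_nonneg u0_bounded that])
  have v_nonneg: "v t x \<ge> 0" for t x using \<phi>pos by (simp add: v_def less_imp_le)
  have vM: "v t x \<le> M" for t x using \<phi>M by (simp add: v_def)
  define Cv where "Cv = C * exp (l1 * \<alpha>0 0)"
  have Cv: "Cv > 0" using C by (simp add: Cv_def)
  have vC: "v t x \<le> Cv * exp (l1 * (x + c * t))" for t x
    using \<phi>C[of "x + \<alpha>0 0 + c * t"]
    by (simp add: v_def Cv_def mult.assoc exp_add[symmetric] algebra_simps)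
  obtain U where U: "\<And>s x. s \<in> {-h..0} \<Longrightarrow> \<bar>u0 s x\<bar> \<le> U"
    using u0_bounded unfolding bounded_iff by fastforce
  have U0: "U \<ge> 0" using U[of 0 0] h by auto
  have init_eq: "u s x = u0 s x" if "s \<in> {-h..0}" for s x
    using sol that by (simp add: kpp_solution_def)
  obtain A0 where A0: "\<And>s. s \<in> {-h..0} \<Longrightarrow> \<alpha>0 s \<le> A0"
  proof -
    have "compact (\<alpha>0 ` {-h..0})" by (rule compact_continuous_image[OF alpha compact_Icc])
    then have "bdd_above (\<alpha>0 ` {-h..0})" by (simp add: bounded_imp_bdd_above compact_imp_bounded)
    then obtain b where "\<forall>y\<in>\<alpha>0 ` {-h..0}. y \<le> b" unfolding bdd_above_def by blast
    then show ?thesis by (intro that[of b]) blast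
  qed

  \<comment> \<open>The initial datum inherits the order \<open>exp (l1 x)\<close> at minus infinity from the wave, because
    the prescribed error is smaller there.\<close>
  define C0 where "C0 = C * exp (l1 * A0) + (K + U + M)"
  have C0: "C0 > 0" using C K U0 M0 by (simp add: C0_def add_pos_pos add_pos_nonneg)
  have u0C: "u0 s x \<le> C0 * exp (l1 * x)" if s: "s \<in> {-h..0}" for s x
  proof -
    let ?d = "u0 s x - \<phi> (x + c * s + \<alpha>0 s)"
    have "?d \<le> (K + U + M) * exp (l1 * x)"
    proof (rule le_exp_of_le_steeper_exp_and_const)
      have "?d \<le> K * exp (lstar * x)" using close s by (auto dest!: bspec spec simp: abs_le_iff)
      also have "\<dots> \<le> (K + U + M) * exp (lstar * x)" using U0 M0 by simp
      finally show "?d \<le> (K + U + M) * exp (lstar * x)" .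
      show "?d \<le> K + U + M"
        using U[OF s, of x] \<phi>pos[of "x + c * s + \<alpha>0 s"] K M0 by linarith
    qed (use K U0 M0 roots lstar_gt in auto)
    moreover have "\<phi> (x + c * s + \<alpha>0 s) \<le> C * exp (l1 * A0) * exp (l1 * x)"
    proof -
      have "c * s \<le> 0" using s c by (simp add: mult_nonneg_nonpos)
      then have "l1 * (x + c * s + \<alpha>0 s) \<le> l1 * (A0 + x)"
        using A0[OF s] roots by (intro mult_left_mono) auto
      then have "C * exp (l1 * (x + c * s + \<alpha>0 s)) \<le> C * exp (l1 * (A0 + x))" using C by simp
      then show ?thesis
        using \<phi>C[of "x + c * s + \<alpha>0 s"] by (simp add: distrib_left exp_add mult.assoc)
    qed
    ultimately show ?thesis by (simp add: C0_def distrib_right)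
  qed
  have uC: "u t x \<le> C0 * exp (l1 * (x + c * t))" if "t \<ge> 0" for t x
  proof (rule kpp_solution_exp_bound[OF sol u_nonneg roots(3) _ _ h that])
    show "u 0 x \<le> C0 * exp (l1 * x)" for x using u0C[of 0 x] init_eq[of 0 x] h by simp
  qed (use C0 in auto)

  define D where "D = C0 + Cv + U + M + K"
  have D: "D > 0" using C0 Cv U0 M0 K by (simp add: D_def)
  have \<delta>D: "\<bar>u s x - v s x\<bar> \<le> D" "\<bar>u s x - v s x\<bar> \<le> D * exp (l1 * x)"
    if s: "s \<in> {-h..0}" for s x
  proof -
    have abs: "\<bar>u s x - v s x\<bar> \<le> u s x + v s x"
      using u_nonneg[of s x] v_nonneg[of s x] s by auto
    then show "\<bar>u s x - v s x\<bar> \<le> D"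
      using U[OF s, of x] vM[of s x] init_eq[OF s, of x] C0 Cv K unfolding D_def by linarith
    have "c * s \<le> 0" using s c by (simp add: mult_nonneg_nonpos)
    then have "Cv * exp (l1 * (x + c * s)) \<le> Cv * exp (l1 * x)" using Cv roots by simp
    then have "v s x \<le> Cv * exp (l1 * x)" using vC[of s x] by linarith
    moreover have "u s x \<le> C0 * exp (l1 * x)" using u0C[OF s] init_eq[OF s] by simp
    ultimately have "\<bar>u s x - v s x\<bar> \<le> (C0 + Cv) * exp (l1 * x)"
      using abs by (simp add: distrib_right)
    also have "\<dots> \<le> D * exp (l1 * x)" using U0 M0 K by (simp add: D_def)
    finally show "\<bar>u s x - v s x\<bar> \<le> D * exp (l1 * x)" .
  qed

  define E where "E = exp (- \<mu> * c * h - \<gamma> * h)"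
  have E: "E > 0" by (simp add: E_def)
  obtain A where A: "A \<ge> 0"
    and tail: "\<And>t x. v t x * E \<le> \<kappa> * (1 + A * exp ((\<nu> - \<mu>) * (x + c * t)))"
  proof -
    have "eventually (\<lambda>z. \<phi> z < \<kappa> / E) at_bot"
      using wave order_tendstoD(2)[of \<phi> 0 at_bot "\<kappa> / E"] \<kappa> E by (auto simp: traveling_wave_def)
    then obtain Z where Z: "\<And>z. z \<le> Z \<Longrightarrow> \<phi> z < \<kappa> / E" by (auto simp: eventually_at_bot_linorder)
    \<comment> \<open>Left of \<open>Z\<close> the smallness of \<open>\<phi>\<close> suffices; \<open>A\<close> makes the second exponential take over
      from \<open>Z\<close> on, where only \<open>\<phi> \<le> M\<close> is known.\<close>
    define A where "A = M * E / \<kappa> * exp (- ((\<nu> - \<mu>) * (Z - \<alpha>0 0)))"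
    have A: "A \<ge> 0" using M0 E \<kappa> by (simp add: A_def)
    show ?thesis
    proof (rule that[OF A])
      fix t x
      show "v t x * E \<le> \<kappa> * (1 + A * exp ((\<nu> - \<mu>) * (x + c * t)))"
      proof (cases "x + \<alpha>0 0 + c * t \<le> Z")
        case True
        have "v t x * E \<le> \<kappa>" using Z[OF True] E by (simp add: v_def field_simps)
        also have "\<dots> \<le> \<kappa> * (1 + A * exp ((\<nu> - \<mu>) * (x + c * t)))" using \<kappa> A by simp
        finally show ?thesis .
      next
        case False
        have "v t x * E \<le> M * E * 1" using vM[of t x] E by simp
        also have "\<dots> \<le> M * E * exp ((\<nu> - \<mu>) * (x + c * t - (Z - \<alpha>0 0)))"
          using False M0 E \<mu> by (intro mult_left_mono) auto
        also have "\<dots> = \<kappa> * (A * exp ((\<nu> - \<mu>) * (x + c * t)))"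
          using \<kappa> by (simp add: A_def mult.assoc exp_add[symmetric] right_diff_distrib add.commute)
        also have "\<dots> \<le> \<kappa> * (1 + A * exp ((\<nu> - \<mu>) * (x + c * t)))" using \<kappa> by simp
        finally show ?thesis .
      qed
    qed
  qed

  \<comment> \<open>The two summands cover the difference at time zero and its past on the first delay interval,
    where the product of two factors of order \<open>exp (l1 z)\<close> is below \<open>exp (\<mu> z)\<close>.\<close>
  define Q where "Q = D + (Cv + M) * D / (exp (\<gamma> * h) * \<kappa>)"
  have Q: "Q \<ge> D" using D Cv M0 \<kappa> by (simp add: Q_def)
  have decay: "\<bar>u t x - v t x\<bar>
      \<le> Q * exp (\<gamma> * t) * (exp (\<mu> * (x + c * t)) + A * exp (\<nu> * (x + c * t)))"
    if "t \<ge> 0" for t x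
  proof (rule perturbation_weighted_decay[where M = M and \<kappa> = \<kappa> and h = h])
    show "continuous_on ({0..} \<times> UNIV) (\<lambda>(t, x). u t x)"
      "bounded ((\<lambda>(t, x). u t x) ` ({0..T} \<times> UNIV))" for T
      using sol by (auto simp: kpp_solution_def)
    show "continuous_on ({0..} \<times> UNIV) (\<lambda>(t, x). v t x)"
    proof -
      obtain \<phi>' \<phi>'' where "\<forall>z. (\<phi> has_real_derivative \<phi>' z) (at z) \<and>
          (\<phi>' has_real_derivative \<phi>'' z) (at z) \<and>
          \<phi>'' z = c * \<phi>' z - \<phi> z * (1 - \<phi> (z - c * h))"
        using wave_profile_ode[OF wave c] by (elim exE)
      then have "continuous_on UNIV \<phi>"
        by (meson DERIV_isCont continuous_at_imp_continuous_on)
      then show ?thesis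
        unfolding v_def case_prod_beta'
        by (rule continuous_on_compose2) (auto intro!: continuous_intros)
    qed
    show "\<bar>u 0 x - v 0 x\<bar> \<le> Q * exp (\<mu> * x)" for x
    proof (rule le_exp_of_le_steeper_exp_and_const)
      have "\<bar>u 0 x - v 0 x\<bar> \<le> K * exp (lstar * x)"
        using close init_eq[of 0 x] h by (auto simp: v_def dest!: bspec[of _ _ 0] spec[of _ x])
      also have "\<dots> \<le> Q * exp (lstar * x)" using Q C0 Cv U0 M0 by (simp add: D_def)
      finally show "\<bar>u 0 x - v 0 x\<bar> \<le> Q * exp (lstar * x)" .
      show "\<bar>u 0 x - v 0 x\<bar> \<le> Q" using \<delta>D(1)[of 0 x] Q h by simp
    qed (use Q D \<mu> roots in auto)
    show "v t x * exp (- \<mu> * c * h - \<gamma> * h) \<le> \<kappa> * (1 + A * exp ((\<nu> - \<mu>) * (x + c * t)))" for t x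
      using tail[of t x] by (simp add: E_def)
    show "v t x * \<bar>u (t - h) x - v (t - h) x\<bar> \<le> Q * exp (\<gamma> * h) * \<kappa> * exp (\<mu> * (x + c * t))"
      if t: "0 < t" "t \<le> h" for t x
    proof -
      have s: "t - h \<in> {-h..0}" using t by auto
      let ?p = "v t x * \<bar>u (t - h) x - v (t - h) x\<bar>"
      have "?p \<le> (Cv + M) * D * exp (\<mu> * (x + c * t))"
      proof (rule le_exp_of_le_steeper_exp_and_const)
        have "?p \<le> ((Cv + M) * exp (l1 * (x + c * t))) * (D * exp (l1 * (x + c * t)))"
        proof (rule mult_mono)
          have "Cv * exp (l1 * (x + c * t)) \<le> (Cv + M) * exp (l1 * (x + c * t))" using M0 by simp
          then show "v t x \<le> (Cv + M) * exp (l1 * (x + c * t))" using vC[of t x] by linarith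
          have "c * t \<ge> 0" using c t by simp
          then have "D * exp (l1 * x) \<le> D * exp (l1 * (x + c * t))" using D roots by simp
          then show "\<bar>u (t - h) x - v (t - h) x\<bar> \<le> D * exp (l1 * (x + c * t))"
            using \<delta>D(2)[OF s, of x] by linarith
        qed (use Cv M0 in auto)
        also have "\<dots> = (Cv + M) * D * exp ((2 * l1) * (x + c * t))"
          by (simp add: mult_exp_exp algebra_simps)
        finally show "?p \<le> (Cv + M) * D * exp ((2 * l1) * (x + c * t))" .
        show "?p \<le> (Cv + M) * D"
          using vM[of t x] \<delta>D(1)[OF s, of x] Cv M0 by (intro mult_mono) auto
      qed (use Cv M0 D \<mu> roots in auto)
      also have "\<dots> \<le> Q * exp (\<gamma> * h) * \<kappa> * exp (\<mu> * (x + c * t))"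
      proof (rule mult_right_mono)
        have "(Cv + M) * D = (Cv + M) * D / (exp (\<gamma> * h) * \<kappa>) * (exp (\<gamma> * h) * \<kappa>)"
          using \<kappa> by simp
        also have "\<dots> \<le> Q * (exp (\<gamma> * h) * \<kappa>)"
          using \<kappa> D unfolding Q_def by (intro mult_right_mono) auto
        finally show "(Cv + M) * D \<le> Q * exp (\<gamma> * h) * \<kappa>" by (simp add: mult.assoc)
      qed simp
      finally show ?thesis .
    qed
  qed (use h equ eqv u_nonneg v_nonneg vM \<gamma> \<kappa> A Q D rate\<mu> rate\<nu> that in auto)

  \<comment> \<open>On the right half-line the weight \<open>\<nu>\<close> is too large; interpolation with the bound
    \<open>exp (l1 z)\<close>, valid for all times, brings it down to \<open>\<mu>\<close>.\<close>
  define \<theta> where "\<theta> = (\<mu> - l1) / (\<nu> - l1)"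
  have \<theta>: "0 < \<theta>" "\<theta> < 1" using \<mu> \<nu>l by (auto simp: \<theta>_def)
  have \<theta>\<mu>: "\<theta> * \<nu> + (1 - \<theta>) * l1 = \<mu>"
  proof -
    have "\<theta> * (\<nu> - l1) = \<mu> - l1" using \<nu>l by (simp add: \<theta>_def)
    then show ?thesis by (simp add: algebra_simps)
  qed
  define N where "N = max K (max (Q * (1 + A)) (C0 + Cv))"
  have N: "N \<ge> K" "N \<ge> Q * (1 + A)" "N \<ge> C0 + Cv" "N \<ge> 0" using K by (auto simp: N_def)
  have final: "\<bar>u t x - v t x\<bar> \<le> N * exp (\<mu> * (x + c * t) + \<theta> * \<gamma> * t)" if t: "t \<ge> 0" for t x
  proof -
    define z where "z = x + c * t"
    have Q0: "Q \<ge> 0" using Q D by simp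
    have dz: "\<bar>u t x - v t x\<bar> \<le> Q * exp (\<gamma> * t) * (exp (\<mu> * z) + A * exp (\<nu> * z))"
      using decay[OF t, of x] by (simp add: z_def)
    have worst: "\<bar>u t x - v t x\<bar> \<le> N * exp (\<gamma> * t + r * z)"
      if "exp (\<mu> * z) \<le> exp (r * z)" "exp (\<nu> * z) \<le> exp (r * z)" for r
    proof -
      have "exp (\<mu> * z) + A * exp (\<nu> * z) \<le> exp (r * z) + A * exp (r * z)"
        using that A by (intro add_mono mult_left_mono) auto
      then have "Q * exp (\<gamma> * t) * (exp (\<mu> * z) + A * exp (\<nu> * z))
          \<le> Q * exp (\<gamma> * t) * (exp (r * z) + A * exp (r * z))"
        using Q0 by (intro mult_left_mono) auto
      also have "\<dots> = Q * (1 + A) * exp (\<gamma> * t + r * z)" by (simp add: exp_add algebra_simps)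
      also have "\<dots> \<le> N * exp (\<gamma> * t + r * z)" using N by (intro mult_right_mono) auto
      finally show ?thesis using dz by linarith
    qed
    show ?thesis
    proof (cases "z \<le> 0")
      case True
      have "\<bar>u t x - v t x\<bar> \<le> N * exp (\<gamma> * t + \<mu> * z)"
        using True \<mu> by (intro worst) (auto simp: mult_right_mono_neg)
      also have "\<dots> \<le> N * exp (\<mu> * z + \<theta> * \<gamma> * t)"
      proof -
        have "\<gamma> * t \<le> \<theta> * (\<gamma> * t)"
          using \<theta> \<gamma> t mult_right_mono_neg[of \<theta> 1 "\<gamma> * t"] by (simp add: mult_nonpos_nonneg)
        then show ?thesis using N by (intro mult_left_mono) auto
      qed
      finally show ?thesis by (simp add: z_def)
    next
      case False
      have "\<bar>u t x - v t x\<bar> \<le> N * exp (\<theta> * (\<gamma> * t + \<nu> * z) + (1 - \<theta>) * (l1 * z))"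
      proof (rule le_interpolated_exp)
        show "\<bar>u t x - v t x\<bar> \<le> N * exp (\<gamma> * t + \<nu> * z)"
          using False \<mu> by (intro worst) (auto simp: mult_right_mono)
        have "\<bar>u t x - v t x\<bar> \<le> (C0 + Cv) * exp (l1 * z)"
          using uC[OF t, of x] vC[of t x] u_nonneg[of t x] v_nonneg[of t x] t h
          by (simp add: z_def distrib_right)
        also have "\<dots> \<le> N * exp (l1 * z)" using N by (intro mult_right_mono) auto
        finally show "\<bar>u t x - v t x\<bar> \<le> N * exp (l1 * z)" .
      qed (use N \<theta> in auto)
      also have "\<theta> * (\<gamma> * t + \<nu> * z) + (1 - \<theta>) * (l1 * z)
          = (\<theta> * \<nu> + (1 - \<theta>) * l1) * z + \<theta> * \<gamma> * t"
        by (simp add: algebra_simps)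
      finally show ?thesis unfolding \<theta>\<mu> by (simp add: z_def)
    qed
  qed
  show ?thesis
  proof (rule exI[of _ \<mu>], rule exI[of _ "\<theta> * \<gamma>"], rule exI[of _ N], intro conjI allI impI)
    show "l1 < \<mu>" "\<mu> < 2 * l1" using \<mu> by auto
    show "\<theta> * \<gamma> < 0" using \<theta> \<gamma> by (simp add: mult_pos_neg)
    show "N \<ge> K" by (rule N)
    fix x t :: real
    assume "t \<ge> 0"
    then show "\<bar>u t x - \<phi> (x + c * t + \<alpha>0 0)\<bar>
        \<le> N * exp (\<mu> * (x + c * t)) * exp (\<theta> * \<gamma> * t)"
      using final[of t x] by (simp add: v_def exp_add mult.assoc add.assoc add.commute[of "\<alpha>0 0"])
  qed
qed

end
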